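(* Let $f:\mathbb{R}^d\to\mathbb{R}$ be differentiable, convex and symmetrically $(L_0,L_1)$-smooth with $L_0>0$, $L_1>0$, and let $x^*\in\arg\min_{x\in\mathbb{R}^d} f(x)$. Let $\nu$ be the real number with $\nu=e^{-\nu}$, let $x^0\in\mathbb{R}^d$, and let $(x^k)_{k\ge0}$ be the iterates of Gradient Descent with Polyak Stepsizes (GD-PS), $$x^{k+1}=x^k-\frac{f(x^k)-f(x^* )}{\|\nabla f(x^k)\|^2}\nabla f(x^k).$$ Then for every $k\ge0$ $$\|\nabla f(x^k)\|\ge\frac{L_0}{L_1}\ \Longrightarrow\ \|x^{k+1}-x^*\|^2\le\|x^k-x^*\|^2-\frac{\nu^2}{16L_1^2}.$$ Moreover, for every integer $N\ge0$, $$\frac{4L_0}{\nu}\|x^{N+1}-x^*\|^2+\sum_{k\in\{0,1,\ldots,N\}\setminus\mathcal{T}}\big(f(x^k)-f(x^* )\big)\le\frac{4L_0}{\nu}\|x^0-x^*\|^2-\frac{\nu L_0T}{4L_1^2},$$ where $\mathcal{T}:=\{k\in\{0,1,\ldots,N\}\mid\|\nabla f(x^k)\|\ge\frac{L_0}{L_1}\}$ and $T:=|\mathcal{T}|$; and if $N>T-1$, then $$f(\hat x^N)-f(x^* )\le\frac{4L_0\|x^0-x^*\|^2}{\nu(N-T+1)}-\frac{\nu L_0T}{4L_1^2(N-T+1)},$$ where $\hat x^N\in\{x^0,\ldots,x^N\}$ is such that $f(\hat x^N)=\min_{x\in\{x^0,\ldots,x^N\}}f(x)$. In particular, for $N>\frac{16L_1^2\|x^0-x^*\|^2}{\nu^2}-1$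 the inequality $N>T-1$ is guaranteed and $$f(\hat x^N)-f(x^* )\le\frac{4L_0\|x^0-x^*\|^2}{\nu(N+1)}.$$ In addition, if $f$ is $\mu$-strongly convex with $\mu>0$ and $N>\frac{16L_1^2\|x^0-x^*\|^2}{\nu^2}-1$, then $$\|x^N-x^*\|^2\le\Big(1-\frac{\mu\nu}{8L_0}\Big)^{N-T}\Big(\|x^0-x^*\|^2-\frac{\nu^2T}{16L_1^2}\Big)\le\Big(1-\frac{\mu\nu}{8L_0}\Big)^{N-T}\|x^0-x^*\|^2.$$
   Context: $\|\cdot\|$ is the Euclidean norm. A differentiable $f:\mathbb{R}^d\to\mathbb{R}$ is $\mu$-strongly convex ($\mu\ge0$) if $f(y)\ge f(x)+\langle\nabla f(x),y-x\rangle+\frac\mu2\|x-y\|^2$ for all $x,y\in\mathbb{R}^d$; convex means $\mu=0$. It is symmetrically $(L_0,L_1)$-smooth if for all $x,y\in\mathbb{R}^d$ $$\|\nabla f(x)-\nabla f(y)\|\le\Big(L_0+L_1\sup_{u\in[x,y]}\|\nabla f(u)\|\Big)\|x-y\|,$$ where $[x,y]$ is the line segment between $x$ and $y$. Convention: if $\nabla f(x^k)=0$ (so $x^k$ is a minimizer), then the GD-PS step is $x^{k+1}=x^k$. *)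

theory Defs
  imports "HOL-Analysis.Analysis"
begin

definition grad :: "('a::euclidean_space \<Rightarrow> real) \<Rightarrow> 'a \<Rightarrow> 'a" where
  "grad f x = (THE D. GDERIV f x :> D)"

lemma GDERIV_grad:
  fixes f :: "'a::euclidean_space \<Rightarrow> real"
  assumes "f differentiable (at x)"
  shows "GDERIV f x :> grad f x"
proof -
  obtain f' where f': "(f has_derivative f') (at x)"
    using assms by (auto simp: differentiable_def)
  then have "linear f'"
    using has_derivative_linear by blast
  then have eq: "f' h = h \<bullet> adjoint f' 1" for h
    using adjoint_works[of f' h 1] by simp
  have "GDERIV f x :> adjoint f' 1"
    unfolding gderiv_def using f' by (simp flip: eq)
  moreover have "D = D'" if "GDERIV f x :> D" "GDERIV f x :> D'" for D D'
  proof -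
    have "(\<lambda>h. h \<bullet> D) = (\<lambda>h. h \<bullet> D')"
      using that has_derivative_unique unfolding gderiv_def by blast
    then show "D = D'"
      by (metis inner_commute vector_eq_rdot)
  qed
  ultimately show ?thesis
    unfolding grad_def by (metis (mono_tags, lifting) theI')
qed

text \<open>Convexity of a differentiable function is the case \<open>\<mu> = 0\<close>.\<close>

definition strongly_convex :: "real \<Rightarrow> ('a::euclidean_space \<Rightarrow> real) \<Rightarrow> bool" where
  "strongly_convex \<mu> f \<longleftrightarrow>
     (\<forall>x y. f y \<ge> f x + grad f x \<bullet> (y - x) + \<mu> / 2 * (norm (x - y))\<^sup>2)"

text \<open>The supremum is taken in the extended reals, so that it is \<open>\<infinity>\<close> (and the condition
  is void) on segments along which the gradient is unbounded, instead of an unspecified real.\<close>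

definition symm_smooth :: "real \<Rightarrow> real \<Rightarrow> ('a::euclidean_space \<Rightarrow> real) \<Rightarrow> bool" where
  "symm_smooth L0 L1 f \<longleftrightarrow>
     (\<forall>x y. ereal (norm (grad f x - grad f y)) \<le>
        (ereal L0 + ereal L1 * (SUP u\<in>closed_segment x y. ereal (norm (grad f u))))
          * ereal (norm (x - y)))"

definition gd_ps_step :: "('a::euclidean_space \<Rightarrow> real) \<Rightarrow> 'a \<Rightarrow> 'a \<Rightarrow> 'a" where
  "gd_ps_step f xstar y =
     (if grad f y = 0 then y
      else y - ((f y - f xstar) / (norm (grad f y))\<^sup>2) *\<^sub>R grad f y)"

definition large_grad :: "('a::euclidean_space \<Rightarrow> real) \<Rightarrow> real \<Rightarrow> real \<Rightarrow> (nat \<Rightarrow> 'a) \<Rightarrow> nat \<Rightarrow> nat set" where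
  "large_grad f L0 L1 x N = {k \<in> {0..N}. norm (grad f (x k)) \<ge> L0 / L1}"

end

(* Chopping a segment into short pieces shows that L0 + L1 |grad f| grows at most by the factor
   exp (L1 r) over a distance r. The resulting descent inequality along -grad f gives a lower
   bound for f - min f in terms of |grad f|, and a Polyak step decreases the squared distance to
   the minimizer by at least ((f - min f) / |grad f|)^2: by a constant if the gradient is large,
   proportionally to f - min f otherwise.

   The strongly convex estimate needs one more idea when grad f (x N) is large, because N is then
   counted in T although the step from x N has not been taken: a step that leads to a large
   gradient also decreases the squared distance by the constant. *)

theory Submission
  imports Defs
begin

section \<open>Growth of the gradient along segments and the descent inequality\<close>

locale convex_symm_smooth =
  fixes f :: "'a::euclidean_space \<Rightarrow> real" and L0 L1 :: real
  assumes differentiable: "f differentiable_on UNIV"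
    and convex: "strongly_convex 0 f"
    and L0_pos: "L0 > 0" and L1_pos: "L1 > 0"
    and smooth: "symm_smooth L0 L1 f"
begin

lemma gradient_ineq: "f x + grad f x \<bullet> (y - x) \<le> f y"
  using convex unfolding strongly_convex_def by simp

lemma has_derivative_grad: "(f has_derivative (\<lambda>h. h \<bullet> grad f x)) (at x)"
  using GDERIV_grad[of f x] differentiable
  by (simp add: gderiv_def differentiable_on_def)

text \<open>By convexity a unit step along the gradient raises \<open>f\<close> by at least the
  gradient norm, and \<open>f\<close> is bounded on the slightly larger ball. This makes the
  supremum in \<open>symm_smooth\<close> finite on every segment.\<close>

lemma bounded_grad_image:
  assumes "bounded S"
  shows "bounded (grad f ` S)"
proof -
  obtain R where R: "norm u \<le> R" if "u \<in> S" for u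
    using assms by (auto simp: bounded_iff)
  have "bounded (f ` cball 0 (R + 1))"
    using differentiable
    by (intro compact_imp_bounded compact_continuous_image compact_cball
        differentiable_imp_continuous_on) (auto intro: differentiable_on_subset)
  then obtain B where "\<forall>u\<in>cball 0 (R + 1). \<bar>f u\<bar> \<le> B"
    by (auto simp: bounded_iff)
  then have B: "\<bar>f u\<bar> \<le> B" if "norm u \<le> R + 1" for u
    using that by simp
  have "norm (grad f u) \<le> 2 * B" if "u \<in> S" for u
  proof (cases "grad f u = 0")
    case True
    then show ?thesis using B[of u] R[OF that] by simp
  next
    case False
    define v where "v = u + sgn (grad f u)"
    have "norm v \<le> R + 1"
      unfolding v_def using R[OF that] norm_triangle_ineq[of u "sgn (grad f u)"] False
      by (simp add: norm_sgn)
    moreover have "grad f u \<bullet> (v - u) = norm (grad f u)"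
      using False by (simp add: v_def sgn_div_norm dot_square_norm power2_eq_square)
    ultimately show ?thesis
      using gradient_ineq[of u v] B[of u] B[of v] R[OF that] by linarith
  qed
  then show ?thesis by (auto simp: bounded_iff)
qed

text \<open>The passage from the extended reals to the reals: the supremum is replaced by any real
  upper bound.\<close>

lemma grad_diff_le:
  assumes "\<And>u. u \<in> closed_segment x y \<Longrightarrow> norm (grad f u) \<le> M"
  shows "norm (grad f x - grad f y) \<le> (L0 + L1 * M) * norm (x - y)"
proof -
  have "(SUP u\<in>closed_segment x y. ereal (norm (grad f u))) \<le> ereal M"
    using assms by (intro SUP_least) simp
  then have "ereal L0 + ereal L1 * (SUP u\<in>closed_segment x y. ereal (norm (grad f u)))
      \<le> ereal L0 + ereal L1 * ereal M"
    using L1_pos by (intro add_left_mono ereal_mult_left_mono) auto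
  then have "ereal (norm (grad f x - grad f y))
      \<le> (ereal L0 + ereal L1 * ereal M) * ereal (norm (x - y))"
    using smooth[unfolded symm_smooth_def, rule_format, of x y]
    by (meson ereal_mult_right_mono ereal_less_eq(5) norm_ge_zero order_trans)
  then show ?thesis by simp
qed

text \<open>The local smoothness constant at \<open>x\<close>. Including \<open>L0\<close> makes its
  growth along a segment purely multiplicative.\<close>

definition growth :: "'a \<Rightarrow> real" where
  "growth x = L0 + L1 * norm (grad f x)"

lemma growth_pos: "growth x > 0"
  unfolding growth_def using L0_pos L1_pos by (simp add: add_pos_nonneg)

text \<open>The first-order form of \<open>growth_exp\<close>. The supremum \<open>M\<close> of the
  gradient norm on the segment is bounded in terms of itself, because smoothness between
  \<open>x\<close> and any point of the segment again involves only \<open>M\<close>; solving for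
  \<open>L0 + L1 * M\<close> gives the factor. For \<open>L1 * norm (x - y) \<ge> 1\<close> the left
  side is nonpositive.\<close>

lemma growth_short_segment:
  "growth y * (1 - L1 * norm (x - y)) \<le> growth x"
proof (cases "L1 * norm (x - y) < 1")
  case False
  then have "growth y * (1 - L1 * norm (x - y)) \<le> 0"
    using growth_pos[of y] by (simp add: mult_le_0_iff)
  then show ?thesis using growth_pos[of x] by linarith
next
  case True
  define M where "M = (SUP u\<in>closed_segment x y. norm (grad f u))"
  have bdd: "bdd_above ((\<lambda>u. norm (grad f u)) ` closed_segment x y)"
    using bounded_grad_image[OF bounded_closed_segment, of x y]
    by (auto simp: bounded_iff bdd_above_def)
  have M: "norm (grad f u) \<le> M" if "u \<in> closed_segment x y" for u
    unfolding M_def using that bdd by (rule cSUP_upper)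
  then have "0 \<le> M"
    by (meson ends_in_segment(1) norm_ge_zero order_trans)
  have "M \<le> norm (grad f x) + (L0 + L1 * M) * norm (x - y)"
    unfolding M_def
  proof (rule cSUP_least, simp, fold M_def)
    fix u assume u: "u \<in> closed_segment x y"
    then have "closed_segment x u \<subseteq> closed_segment x y"
      by (simp add: subset_closed_segment)
    then have "norm (grad f x - grad f u) \<le> (L0 + L1 * M) * norm (x - u)"
      by (intro grad_diff_le) (auto intro: M)
    also have "\<dots> \<le> (L0 + L1 * M) * norm (x - y)"
      using u \<open>0 \<le> M\<close> L0_pos L1_pos
      by (intro mult_left_mono) (auto dest: segment_bound1 simp: norm_minus_commute)
    finally show "norm (grad f u) \<le> norm (grad f x) + (L0 + L1 * M) * norm (x - y)"
      using norm_triangle_ineq2[of "grad f u" "grad f x"]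
      by (simp add: norm_minus_commute)
  qed
  from mult_left_mono[OF this, of L1]
  have "(L0 + L1 * M) * (1 - L1 * norm (x - y)) \<le> growth x"
    using L1_pos by (simp add: growth_def algebra_simps)
  moreover have "growth y \<le> L0 + L1 * M"
    unfolding growth_def using M[of y] L1_pos by simp
  ultimately show ?thesis
    using True by (smt (verit) mult_right_mono)
qed

text \<open>Over \<open>n\<close> equal pieces the short-segment bound gives the factor
  \<open>(1 - r / n) ^ n\<close>, which tends to \<open>exp (- r)\<close>. Taking
  \<open>n > r\<close> keeps each factor nonnegative, so that the bounds can be multiplied.\<close>

lemma growth_exp: "growth y \<le> growth x * exp (L1 * norm (x - y))"
proof -
  define r where "r = L1 * norm (x - y)"
  have chop: "growth y * (1 + (- r) / real n) ^ n \<le> growth x" if n: "real n > r" "n > 0" for n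
  proof -
    define z where "z i = x + (real i / real n) *\<^sub>R (y - x)" for i
    have step: "norm (z i - z (Suc i)) = norm (x - y) / real n" for i
    proof -
      have "z i - z (Suc i) = (1 / real n) *\<^sub>R (x - y)"
        by (simp add: z_def algebra_simps add_divide_distrib)
      then show ?thesis by simp
    qed
    have nonneg: "1 + (- r) / real n \<ge> 0" using n by (simp add: field_simps)
    have "growth (z i) * (1 + (- r) / real n) ^ i \<le> growth x" for i
    proof (induction i)
      case 0
      then show ?case by (simp add: z_def)
    next
      case (Suc i)
      have "growth (z (Suc i)) * (1 + (- r) / real n) \<le> growth (z i)"
        using growth_short_segment[of "z (Suc i)" "z i"] by (simp add: step r_def)
      from mult_right_mono[OF this, of "(1 + (- r) / real n) ^ i"] Suc nonneg
      show ?case by (simp add: mult.assoc)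
    qed
    from this[of n] show ?thesis using n by (simp add: z_def)
  qed
  have "(\<lambda>n. growth y * (1 + (- r) / real n) ^ n) \<longlonglongrightarrow> growth y * exp (- r)"
    by (intro tendsto_intros tendsto_exp_limit_sequentially)
  moreover have "\<forall>\<^sub>F n in sequentially. growth y * (1 + (- r) / real n) ^ n \<le> growth x"
    using eventually_gt_at_top[of "nat \<lceil>r\<rceil>"]
  proof eventually_elim
    case (elim n)
    then have "r < real n" by linarith
    with elim show ?case by (intro chop) auto
  qed
  ultimately have "growth y * exp (- r) \<le> growth x"
    by (intro tendsto_upperbound) auto
  then show ?thesis by (simp add: r_def exp_minus field_simps)
qed

lemma grad_diff_exp_le:
  "norm (grad f x - grad f y) \<le> growth x * exp (L1 * norm (x - y)) * norm (x - y)"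
proof -
  define E where "E = growth x * exp (L1 * norm (x - y))"
  \<comment> \<open>By \<open>growth_exp\<close>, \<open>E\<close> bounds \<open>growth\<close> on
    the whole segment; \<open>M = (E - L0) / L1\<close> is the solution of
    \<open>L0 + L1 * M = E\<close>.\<close>
  have "norm (grad f u) \<le> (E - L0) / L1" if u: "u \<in> closed_segment x y" for u
  proof -
    have "growth u \<le> growth x * exp (L1 * norm (x - u))" by (rule growth_exp)
    also have "\<dots> \<le> E"
      unfolding E_def using segment_bound1[OF u] growth_pos[of x] L1_pos
      by (simp add: norm_minus_commute)
    finally show ?thesis
      using L1_pos by (simp add: growth_def field_simps)
  qed
  from grad_diff_le[OF this] L1_pos show ?thesis by (simp add: E_def)
qed

lemma descent:
  assumes v: "norm v = 1" and r: "r \<ge> 0"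
  shows "f (x + r *\<^sub>R v) \<le> f x + r * (grad f x \<bullet> v) + growth x * exp (L1 * r) / 2 * r\<^sup>2"
proof -
  define K where "K = growth x * exp (L1 * r)"
  \<comment> \<open>The claim is \<open>h r \<le> h 0\<close>. With the exponential frozen at its
    value for the endpoint \<open>r\<close>, the gradient estimate makes the derivative of
    \<open>h\<close> nonpositive on all of \<open>[0, r]\<close>.\<close>
  define h where "h t = f (x + t *\<^sub>R v) - t * (grad f x \<bullet> v) - K / 2 * t\<^sup>2" for t
  have deriv: "(h has_real_derivative ((grad f (x + t *\<^sub>R v) - grad f x) \<bullet> v - K * t)) (at t)" for t
  proof -
    have "((\<lambda>t. f (x + t *\<^sub>R v)) has_derivative (\<lambda>s. (s *\<^sub>R v) \<bullet> grad f (x + t *\<^sub>R v))) (at t)"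
      by (rule has_derivative_compose[OF _ has_derivative_grad]) (auto intro!: derivative_eq_intros)
    then have "((\<lambda>t. f (x + t *\<^sub>R v)) has_real_derivative (grad f (x + t *\<^sub>R v) \<bullet> v)) (at t)"
      by (simp add: has_field_derivative_def inner_commute mult_commute_abs)
    then show ?thesis
      unfolding h_def by (auto intro!: derivative_eq_intros simp: inner_diff_left)
  qed
  have "h r \<le> h 0"
  proof (rule DERIV_nonpos_imp_nonincreasing[OF r])
    fix t assume t: "0 \<le> t" "t \<le> r"
    have "(grad f (x + t *\<^sub>R v) - grad f x) \<bullet> v \<le> norm (grad f x - grad f (x + t *\<^sub>R v))"
      using norm_cauchy_schwarz[of "grad f (x + t *\<^sub>R v) - grad f x" v] v
      by (simp add: norm_minus_commute)
    also have "\<dots> \<le> growth x * exp (L1 * t) * t"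
      using grad_diff_exp_le[of x "x + t *\<^sub>R v"] v t by simp
    also have "\<dots> \<le> K * t"
      unfolding K_def using t growth_pos[of x] L1_pos
      by (intro mult_right_mono mult_left_mono) auto
    finally show "\<exists>y. (h has_real_derivative y) (at t) \<and> y \<le> 0"
      using deriv[of t] by auto
  qed
  then show ?thesis by (simp add: h_def K_def)
qed

end

section \<open>Counting steps of a sequence with both subtractive and multiplicative
  decreases\<close>

lemma contraction_count:
  fixes a :: "nat \<Rightarrow> real"
  assumes q: "0 \<le> q" "q \<le> 1" and c: "0 \<le> c"
    and dec: "\<And>k. k < n \<Longrightarrow> k \<in> S \<Longrightarrow> a (Suc k) \<le> a k - c"
    and contr: "\<And>k. k < n \<Longrightarrow> k \<notin> S \<Longrightarrow> a (Suc k) \<le> q * a k"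
  shows "a n \<le> q ^ (n - card (S \<inter> {..<n})) * (a 0 - c * real (card (S \<inter> {..<n})))"
  using dec contr
proof (induction n)
  case 0
  then show ?case by simp
next
  case (Suc n)
  define t where "t = card (S \<inter> {..<n})"
  have IH: "a n \<le> q ^ (n - t) * (a 0 - c * real t)"
    using Suc by (simp add: t_def)
  have t: "t \<le> n"
    unfolding t_def by (metis Int_lower2 card_lessThan card_mono finite_lessThan)
  show ?case
  proof (cases "n \<in> S")
    case True
    then have card: "card (S \<inter> {..<Suc n}) = Suc t"
      by (simp add: lessThan_Suc t_def)
    have "a (Suc n) \<le> q ^ (n - t) * (a 0 - c * real t) - c"
      using Suc.prems(1)[of n] True IH by simp
    \<comment> \<open>The order of the two kinds of steps is immaterial for the bound: letting the
      earlier contractions act on the newly subtracted \<open>c\<close> as well only weakens it,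
      since \<open>q ^ (n - t) \<le> 1\<close>.\<close>
    also have "\<dots> \<le> q ^ (n - t) * (a 0 - c * real t) - q ^ (n - t) * c"
      using mult_right_mono[of "q ^ (n - t)" 1 c] q c by (simp add: power_le_one)
    also have "\<dots> = q ^ (n - t) * (a 0 - c * real (Suc t))"
      by (simp add: algebra_simps)
    finally show ?thesis by (simp add: card)
  next
    case False
    then have card: "card (S \<inter> {..<Suc n}) = t"
      by (simp add: lessThan_Suc t_def)
    have "a (Suc n) \<le> q * (q ^ (n - t) * (a 0 - c * real t))"
      using Suc.prems(2)[of n] False mult_left_mono[OF IH, of q] q by simp
    then show ?thesis using t by (simp add: card Suc_diff_le)
  qed
qed

section \<open>The gap to the minimum and the decrease in one Polyak step\<close>

locale convex_symm_smooth_min = convex_symm_smooth f L0 L1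
  for f :: "'a::euclidean_space \<Rightarrow> real" and L0 L1 :: real +
  fixes xstar :: 'a and \<nu> :: real
  assumes minimizer: "is_arg_min f (\<lambda>_. True) xstar"
    and nu_eq: "\<nu> = exp (- \<nu>)"
begin

lemma min_le: "f xstar \<le> f y"
  using minimizer by (auto simp: is_arg_min_def not_less)

lemma nu_pos: "\<nu> > 0"
  by (subst nu_eq) simp

text \<open>\<nu> is the omega constant, about 0.567, the solution of
  \<open>\<nu> * exp \<nu> = 1\<close>. Bounding \<open>exp\<close> below by its quadratic Taylor
  polynomial already makes this product exceed 1 beyond 29/50.\<close>

lemma nu_le: "\<nu> \<le> 29/50"
proof (rule ccontr)
  assume "\<not> ?thesis"
  then have *: "\<nu> > 29/50" by simp
  then have "exp \<nu> \<ge> 1 + 29/50 + (29/50)\<^sup>2 / 2"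
    using exp_lower_Taylor_quadratic[of \<nu>] power_mono[of "29/50" \<nu> 2]
    by (simp add: power2_eq_square)
  then have "\<nu> * exp \<nu> > 29/50 * (1 + 29/50 + (29/50)\<^sup>2 / 2)"
    using * by (intro mult_less_le_imp_less) (auto simp: power2_eq_square)
  moreover have "\<nu> * exp \<nu> = 1"
    by (subst nu_eq) (simp flip: exp_add)
  ultimately show False by (simp add: power2_eq_square)
qed

text \<open>A walk of length \<open>r\<close> against the gradient cannot end below the minimum. The
  length stays free because two different choices are made later.\<close>

lemma gap_ge:
  assumes "r \<ge> 0"
  shows "f y - f xstar \<ge> r * norm (grad f y) - growth y * exp (L1 * r) / 2 * r\<^sup>2"
proof (cases "grad f y = 0")
  case True
  moreover have "0 \<le> growth y * exp (L1 * r) / 2 * r\<^sup>2"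
    using growth_pos[of y] by simp
  ultimately show ?thesis using min_le[of y] by simp
next
  case False
  have "grad f y \<bullet> (- sgn (grad f y)) = - norm (grad f y)"
    using False by (simp add: sgn_div_norm dot_square_norm power2_eq_square)
  with descent[of "- sgn (grad f y)" r y] False assms min_le[of "y + r *\<^sub>R (- sgn (grad f y))"]
  show ?thesis by (simp add: norm_sgn)
qed

text \<open>The length \<open>r = \<nu> * g / growth y\<close> forces
  \<open>L1 * r \<le> \<nu>\<close>, so the exponential in \<open>gap_ge\<close> is at most
  \<open>exp \<nu> = 1 / \<nu>\<close>. With \<open>1 / \<nu>\<close> in its place, the same
  \<open>r\<close> maximizes the lower bound; this is where the equation for \<nu> comes
  from.\<close>

lemma gap_ge_grad: "f y - f xstar \<ge> \<nu> * (norm (grad f y))\<^sup>2 / (2 * growth y)"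
proof -
  define g where "g = norm (grad f y)"
  define r where "r = \<nu> * g / growth y"
  have gr: "growth y > 0" by (rule growth_pos)
  have r0: "r \<ge> 0" using nu_pos gr by (simp add: r_def g_def)
  have "L1 * g \<le> growth y" using L0_pos by (simp add: growth_def g_def)
  then have "L1 * r \<le> \<nu>"
    using gr nu_pos by (simp add: r_def field_simps)
  then have "exp (L1 * r) \<le> exp \<nu>" by simp
  also have "\<dots> = 1 / \<nu>" using nu_eq by (metis exp_minus inverse_eq_divide inverse_inverse_eq)
  finally have "growth y * exp (L1 * r) / 2 * r\<^sup>2 \<le> growth y * (1 / \<nu>) / 2 * r\<^sup>2"
    using gr by (intro mult_right_mono divide_right_mono mult_left_mono) auto
  moreover have "r * g - growth y * (1 / \<nu>) / 2 * r\<^sup>2 = \<nu> * g\<^sup>2 / (2 * growth y)"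
    using gr nu_pos by (simp add: r_def power2_eq_square field_simps)
  ultimately show ?thesis using gap_ge[OF r0, of y] by (simp add: g_def)
qed

lemma grad_minimizer: "grad f xstar = 0"
proof -
  have "\<nu> * (norm (grad f xstar))\<^sup>2 / (2 * growth xstar) \<le> 0"
    using gap_ge_grad[of xstar] by simp
  then show ?thesis
    using nu_pos growth_pos[of xstar] by (simp add: divide_le_0_iff mult_le_0_iff)
qed

lemma gap_eq_0: "grad f y = 0 \<Longrightarrow> f y = f xstar"
  using gradient_ineq[of y xstar] min_le[of y] by simp

text \<open>At a stationary point both sides are equal, since the quotient is \<open>0 / 0 = 0\<close>.\<close>

lemma dist_step:
  "(norm (gd_ps_step f xstar y - xstar))\<^sup>2
     \<le> (norm (y - xstar))\<^sup>2 - ((f y - f xstar) / norm (grad f y))\<^sup>2"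
proof (cases "grad f y = 0")
  case True
  then show ?thesis by (simp add: gd_ps_step_def)
next
  case False
  define g where "g = norm (grad f y)"
  define D where "D = f y - f xstar"
  have g: "g > 0" using False by (simp add: g_def)
  have D: "D \<ge> 0" "D \<le> grad f y \<bullet> (y - xstar)"
    using min_le[of y] gradient_ineq[of y xstar] by (simp_all add: D_def inner_diff_right)
  have norm_diff_sq: "(norm (u - v))\<^sup>2 = (norm u)\<^sup>2 - 2 * (u \<bullet> v) + (norm v)\<^sup>2" for u v :: 'a
    by (simp add: power2_norm_eq_inner inner_diff_left inner_diff_right inner_commute)
  have "(norm (gd_ps_step f xstar y - xstar))\<^sup>2
      = (norm ((y - xstar) - (D / g\<^sup>2) *\<^sub>R grad f y))\<^sup>2"
    using False by (simp add: gd_ps_step_def D_def g_def algebra_simps)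
  also have "\<dots> = (norm (y - xstar))\<^sup>2 - 2 * (D / g\<^sup>2) * (grad f y \<bullet> (y - xstar)) + (D / g\<^sup>2)\<^sup>2 * g\<^sup>2"
    by (simp only: norm_diff_sq) (simp add: g_def power_mult_distrib power_divide inner_commute mult_ac)
  \<comment> \<open>Convexity bounds the inner product below by \<open>D\<close>. The Polyak
    stepsize \<open>D / g\<^sup>2\<close> is the minimizer over \<open>t\<close> of the resulting
    \<open>- 2 * t * D + t\<^sup>2 * g\<^sup>2\<close>.\<close>
  also have "\<dots> \<le> (norm (y - xstar))\<^sup>2 - 2 * (D / g\<^sup>2) * D + (D / g\<^sup>2)\<^sup>2 * g\<^sup>2"
    using D g by (simp add: mult_left_mono divide_right_mono)
  also have "\<dots> = (norm (y - xstar))\<^sup>2 - (D / g)\<^sup>2"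
    using g by (simp add: power2_eq_square field_simps)
  finally show ?thesis by (simp add: D_def g_def)
qed

text \<open>Here \<open>L1 * g\<close> dominates \<open>L0\<close>, so
  \<open>growth y \<le> 2 * L1 * g\<close> and \<open>gap_ge_grad\<close> becomes linear in
  \<open>g\<close>: the step length \<open>(f y - f xstar) / g\<close> is bounded below by a
  constant.\<close>

lemma dist_step_large:
  assumes "norm (grad f y) \<ge> L0 / L1"
  shows "(norm (gd_ps_step f xstar y - xstar))\<^sup>2 \<le> (norm (y - xstar))\<^sup>2 - \<nu>\<^sup>2 / (16 * L1\<^sup>2)"
proof -
  define g where "g = norm (grad f y)"
  have g: "g > 0" using assms L0_pos L1_pos by (smt (verit) divide_pos_pos g_def)
  have "growth y \<le> 2 * L1 * g"
    using assms L1_pos by (simp add: growth_def g_def field_simps)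
  then have "\<nu> * g\<^sup>2 / (2 * (2 * L1 * g)) \<le> \<nu> * g\<^sup>2 / (2 * growth y)"
    using growth_pos[of y] nu_pos g L1_pos
    by (intro divide_left_mono mult_nonneg_nonneg mult_pos_pos) auto
  also have "\<dots> \<le> f y - f xstar" using gap_ge_grad by (simp add: g_def)
  finally have "\<nu> / (4 * L1) \<le> (f y - f xstar) / g"
    using g L1_pos by (simp add: power2_eq_square field_simps)
  then have "(\<nu> / (4 * L1))\<^sup>2 \<le> ((f y - f xstar) / g)\<^sup>2"
    using nu_pos L1_pos by (intro power_mono) auto
  then show ?thesis
    using dist_step[of y] by (simp add: g_def power_divide power_mult_distrib)
qed

text \<open>Now \<open>growth y \<le> 2 * L0\<close>, so \<open>gap_ge_grad\<close> bounds the
  stepsize \<open>D / g\<^sup>2\<close> below; the other factor \<open>D\<close> of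
  \<open>(D / g)\<^sup>2\<close> is kept.\<close>

lemma dist_step_small:
  assumes "norm (grad f y) < L0 / L1"
  shows "(norm (gd_ps_step f xstar y - xstar))\<^sup>2
    \<le> (norm (y - xstar))\<^sup>2 - \<nu> / (4 * L0) * (f y - f xstar)"
proof (cases "grad f y = 0")
  case True
  then show ?thesis by (simp add: gd_ps_step_def gap_eq_0)
next
  case False
  define g where "g = norm (grad f y)"
  define D where "D = f y - f xstar"
  have g: "g > 0" using False by (simp add: g_def)
  have D: "D \<ge> 0" using min_le[of y] by (simp add: D_def)
  have "growth y \<le> 2 * L0"
    using assms L1_pos by (simp add: growth_def field_simps)
  then have "\<nu> * g\<^sup>2 / (2 * (2 * L0)) \<le> \<nu> * g\<^sup>2 / (2 * growth y)"
    using growth_pos[of y] nu_pos L0_pos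
    by (intro divide_left_mono mult_nonneg_nonneg mult_pos_pos) auto
  also have "\<dots> \<le> D" using gap_ge_grad by (simp add: g_def D_def)
  finally have "\<nu> / (4 * L0) \<le> D / g\<^sup>2"
    using g L0_pos by (simp add: field_simps)
  from mult_right_mono[OF this D] have "\<nu> / (4 * L0) * D \<le> (D / g)\<^sup>2"
    by (simp add: power2_eq_square)
  then show ?thesis using dist_step[of y] by (simp add: g_def D_def)
qed

text \<open>If the gradient is large after a step, the step was long or the gradient was already
  at least \<open>71/100 * L0 / L1\<close> before it; in the latter case \<open>gap_ge\<close> with \<open>r = 1 / (4 * L1)\<close>
  makes the step long as well.\<close>

lemma dist_step_large_next:
  assumes "norm (grad f (gd_ps_step f xstar y)) \<ge> L0 / L1"
  shows "(norm (gd_ps_step f xstar y - xstar))\<^sup>2 \<le> (norm (y - xstar))\<^sup>2 - \<nu>\<^sup>2 / (16 * L1\<^sup>2)"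
proof -
  define z where "z = gd_ps_step f xstar y"
  define g where "g = norm (grad f y)"
  define s where "s = (f y - f xstar) / g"
  have "grad f y \<noteq> 0"
  proof
    assume "grad f y = 0"
    with assms have "L0 / L1 \<le> 0" by (simp add: gd_ps_step_def)
    with L0_pos L1_pos show False by (simp add: divide_le_0_iff)
  qed
  then have g: "g > 0" by (simp add: g_def)
  have s0: "s \<ge> 0" using min_le[of y] g by (simp add: s_def)
  have "y - z = ((f y - f xstar) / g\<^sup>2) *\<^sub>R grad f y"
    using \<open>grad f y \<noteq> 0\<close> by (simp add: z_def gd_ps_step_def g_def)
  then have dist: "norm (y - z) = s"
    using g min_le[of y] by (simp add: s_def g_def power2_eq_square)
  have "s \<ge> \<nu> / (4 * L1)"
  proof (rule ccontr)
    assume "\<not> ?thesis"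
    then have "L1 * s < \<nu> / 4" using L1_pos by (simp add: field_simps)
    with nu_le have Ls: "L1 * s \<le> 29/200" by linarith
    have "1 - 29/200 \<le> exp (- (L1 * s))"
      using exp_ge_add_one_self[of "- (L1 * s)"] Ls by linarith
    \<comment> \<open>\<open>growth z \<ge> 2 * L0\<close>, and going back to \<open>y\<close> over
      the short distance \<open>s\<close> costs at most the factor 171/200. This leaves
      \<open>growth y \<ge> 171/100 * L0\<close>, hence the 71/100 below.\<close>
    then have "2 * L0 * (1 - 29/200) \<le> growth z * exp (- (L1 * s))"
      using assms L0_pos L1_pos growth_pos[of z]
      by (intro mult_mono) (auto simp: z_def growth_def field_simps)
    also have "\<dots> \<le> growth y"
      using growth_exp[of z y] by (simp add: dist exp_minus field_simps)
    finally have "71/100 * L0 \<le> L1 * g" by (simp add: growth_def g_def)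
    then have gr: "growth y \<le> 171/71 * (L1 * g)" by (simp add: growth_def g_def)
    have "exp (1/4::real) \<le> 4/3"
      using exp_ge_add_one_self[of "- (1/4)::real"] by (simp add: exp_minus field_simps)
    then have "growth y * exp (1/4) \<le> 171/71 * (L1 * g) * (4/3)"
      using gr L1_pos g by (intro mult_mono) auto
    then have "growth y * exp (1/4) / 2 * (1 / (4 * L1))\<^sup>2
        \<le> 171/71 * (L1 * g) * (4/3) / 2 * (1 / (4 * L1))\<^sup>2"
      by (intro mult_right_mono) auto
    also have "\<dots> = 57/568 * (g / L1)"
      using L1_pos by (simp add: power2_eq_square field_simps)
    \<comment> \<open>The exponential in \<open>gap_ge\<close> is \<open>exp (1/4)\<close> for this
      \<open>r\<close>. The remaining coefficient 1/4 - 57/568 = 85/568 is about 0.1496, just above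
      the 29/200 allowed by \<open>Ls\<close>.\<close>
    finally have "f y - f xstar \<ge> g / (4 * L1) - 57/568 * (g / L1)"
      using gap_ge[of "1 / (4 * L1)" y] L1_pos by (simp add: g_def)
    then have "(f y - f xstar) / g \<ge> (g / (4 * L1) - 57/568 * (g / L1)) / g"
      using g by (intro divide_right_mono) auto
    also have "(g / (4 * L1) - 57/568 * (g / L1)) / g = (85/568) / L1"
      using g L1_pos by (simp add: field_simps)
    finally have "85/568 \<le> L1 * s" using L1_pos by (simp add: s_def field_simps)
    with Ls show False by simp
  qed
  then have "(\<nu> / (4 * L1))\<^sup>2 \<le> s\<^sup>2"
    using nu_pos L1_pos by (intro power_mono) auto
  then show ?thesis
    using dist_step[of y] by (simp add: s_def g_def power_divide power_mult_distrib)
qed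

text \<open>At distance \<open>1 / (2 * L1)\<close> from the minimizer, where \<open>growth\<close>
  is \<open>L0\<close>, the lower bound from strong convexity meets the upper bound from
  \<open>descent\<close>. It serves to make the contraction factor nonnegative.\<close>

lemma strong_convexity_le:
  assumes "strongly_convex \<mu> f"
  shows "\<mu> \<le> 2 * L0"
proof -
  obtain b :: 'a where b: "norm b = 1"
    using vector_choose_size[of 1] by auto
  define r where "r = 1 / (2 * L1)"
  have r: "r > 0" using L1_pos by (simp add: r_def)
  have "exp (1/2::real) \<le> 2"
    using exp_ge_add_one_self[of "- (1/2)::real"] by (simp add: exp_minus field_simps)
  then have e: "exp (L1 * r) \<le> 2" using L1_pos by (simp add: r_def)
  have "f xstar + \<mu> / 2 * r\<^sup>2 \<le> f (xstar + r *\<^sub>R b)"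
    using assms[unfolded strongly_convex_def, rule_format, of xstar "xstar + r *\<^sub>R b"] b
    by (simp add: grad_minimizer)
  also have "\<dots> \<le> f xstar + L0 * exp (L1 * r) / 2 * r\<^sup>2"
    using descent[OF b, of r xstar] r by (simp add: grad_minimizer growth_def)
  finally have "\<mu> \<le> L0 * exp (L1 * r)" using r by simp
  also have "\<dots> \<le> L0 * 2" using e L0_pos by simp
  finally show ?thesis by simp
qed

lemma gap_ge_strong:
  assumes "strongly_convex \<mu> f"
  shows "\<mu> / 2 * (norm (y - xstar))\<^sup>2 \<le> f y - f xstar"
  using assms[unfolded strongly_convex_def, rule_format, of xstar y]
  by (simp add: grad_minimizer norm_minus_commute)

lemma strong_contraction_factor:
  assumes "\<mu> > 0" "strongly_convex \<mu> f"
  shows "0 \<le> 1 - \<mu> * \<nu> / (8 * L0)" "1 - \<mu> * \<nu> / (8 * L0) \<le> 1"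
proof -
  have "\<mu> * \<nu> \<le> 2 * L0 * 1"
    using strong_convexity_le[OF assms(2)] assms(1) nu_pos nu_le L0_pos
    by (intro mult_mono) auto
  then show "0 \<le> 1 - \<mu> * \<nu> / (8 * L0)" using L0_pos by (simp add: field_simps)
  show "1 - \<mu> * \<nu> / (8 * L0) \<le> 1" using assms(1) nu_pos L0_pos by simp
qed

section \<open>Estimates along the whole sequence of iterates\<close>

context
  fixes x :: "nat \<Rightarrow> 'a"
  assumes step: "\<And>k. x (Suc k) = gd_ps_step f xstar (x k)"
begin

text \<open>The weight \<open>4 * L0 / \<nu>\<close> normalizes the one-step estimates: a
  small-gradient step contributes exactly its gap, a large-gradient step the constant
  \<open>e\<close>. Then the squared distances telescope.\<close>

lemma sum_gap_le:
  fixes N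
  defines "\<T> \<equiv> large_grad f L0 L1 x N"
  shows "4 * L0 / \<nu> * (norm (x (Suc N) - xstar))\<^sup>2 + (\<Sum>k\<in>{0..N} - \<T>. f (x k) - f xstar)
    \<le> 4 * L0 / \<nu> * (norm (x 0 - xstar))\<^sup>2 - \<nu> * L0 * real (card \<T>) / (4 * L1\<^sup>2)"
proof -
  define a where "a k = 4 * L0 / \<nu> * (norm (x k - xstar))\<^sup>2" for k
  define e where "e = \<nu> * L0 / (4 * L1\<^sup>2)"
  have w: "4 * L0 / \<nu> \<ge> 0" using L0_pos nu_pos by simp
  have dec: "a (Suc k) - a k \<le> - (if k \<in> \<T> then e else f (x k) - f xstar)" if "k \<in> {0..N}" for k
  proof (cases "k \<in> \<T>")
    case True
    then have "L0 / L1 \<le> norm (grad f (x k))" by (simp add: \<T>_def large_grad_def)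
    from mult_left_mono[OF dist_step_large[OF this] w]
    have "a (Suc k) \<le> a k - 4 * L0 / \<nu> * (\<nu>\<^sup>2 / (16 * L1\<^sup>2))"
      unfolding a_def step right_diff_distrib .
    also have "4 * L0 / \<nu> * (\<nu>\<^sup>2 / (16 * L1\<^sup>2)) = e"
      using nu_pos by (simp add: e_def power2_eq_square)
    finally show ?thesis using True by simp
  next
    case False
    then have "norm (grad f (x k)) < L0 / L1" using that by (simp add: \<T>_def large_grad_def)
    from mult_left_mono[OF dist_step_small[OF this] w]
    have "a (Suc k) \<le> a k - 4 * L0 / \<nu> * (\<nu> / (4 * L0) * (f (x k) - f xstar))"
      unfolding a_def step right_diff_distrib .
    also have "4 * L0 / \<nu> * (\<nu> / (4 * L0) * (f (x k) - f xstar)) = f (x k) - f xstar"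
      using nu_pos L0_pos by simp
    finally show ?thesis using False by simp
  qed
  have "a (Suc N) - a 0 = (\<Sum>k\<in>{0..N}. a (Suc k) - a k)"
    using sum_lessThan_telescope[of a "Suc N"] by (simp only: lessThan_Suc_atMost atMost_atLeast0)
  also have "\<dots> \<le> (\<Sum>k\<in>{0..N}. - (if k \<in> \<T> then e else f (x k) - f xstar))"
    by (rule sum_mono) (rule dec)
  also have "\<dots> = - (real (card \<T>) * e) - (\<Sum>k\<in>{0..N} - \<T>. f (x k) - f xstar)"
  proof -
    have "{0..N} \<inter> {k. k \<in> \<T>} = \<T>" "{0..N} \<inter> - {k. k \<in> \<T>} = {0..N} - \<T>"
      by (auto simp: \<T>_def large_grad_def)
    then show ?thesis by (simp add: sum_negf sum.If_cases)
  qed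
  finally show ?thesis by (simp add: a_def e_def mult.commute)
qed

text \<open>Every large-gradient step uses up a fixed amount of the initial squared distance; the
  nonnegative left side of \<open>sum_gap_le\<close> is discarded.\<close>

lemma card_large_le:
  "real (card (large_grad f L0 L1 x N)) * \<nu>\<^sup>2 / (16 * L1\<^sup>2) \<le> (norm (x 0 - xstar))\<^sup>2"
proof -
  let ?T = "large_grad f L0 L1 x N"
  have w: "4 * L0 / \<nu> > 0" using L0_pos nu_pos by simp
  have "0 \<le> 4 * L0 / \<nu> * (norm (x (Suc N) - xstar))\<^sup>2 + (\<Sum>k\<in>{0..N} - ?T. f (x k) - f xstar)"
    using w min_le by (intro add_nonneg_nonneg sum_nonneg mult_nonneg_nonneg) auto
  with sum_gap_le[of N]
  have "4 * L0 / \<nu> * (real (card ?T) * \<nu>\<^sup>2 / (16 * L1\<^sup>2)) \<le> 4 * L0 / \<nu> * (norm (x 0 - xstar))\<^sup>2"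
    using nu_pos by (simp add: power2_eq_square mult_ac)
  with w show ?thesis by (simp only: mult_le_cancel_left_pos)
qed

lemma card_large_less:
  assumes "real N > 16 * L1\<^sup>2 * (norm (x 0 - xstar))\<^sup>2 / \<nu>\<^sup>2 - 1"
  shows "card (large_grad f L0 L1 x N) \<le> N"
proof -
  have "real (card (large_grad f L0 L1 x N)) \<le> 16 * L1\<^sup>2 * (norm (x 0 - xstar))\<^sup>2 / \<nu>\<^sup>2"
    using card_large_le[of N] nu_pos L1_pos by (simp add: field_simps)
  with assms show ?thesis by linarith
qed

text \<open>The best gap is at most the average gap over the \<open>N - T + 1\<close> indices with
  small gradient.\<close>

lemma best_iterate_gap_le:
  fixes N
  defines "T \<equiv> card (large_grad f L0 L1 x N)"
  assumes N: "real N > real T - 1" and best: "f xhat = Min (f ` x ` {0..N})"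
  shows "f xhat - f xstar \<le> 4 * L0 * (norm (x 0 - xstar))\<^sup>2 / (\<nu> * (real N - real T + 1))
    - \<nu> * L0 * real T / (4 * L1\<^sup>2 * (real N - real T + 1))"
proof -
  let ?T = "large_grad f L0 L1 x N"
  define m where "m = real N - real T + 1"
  define A where "A = 4 * L0 / \<nu> * (norm (x 0 - xstar))\<^sup>2"
  define B where "B = \<nu> * L0 * real T / (4 * L1\<^sup>2)"
  have m: "m > 0" using N by (simp add: m_def)
  have "card ({0..N} - ?T) = Suc N - T"
    unfolding T_def by (subst card_Diff_subset) (auto simp: large_grad_def)
  then have card: "real (card ({0..N} - ?T)) = m"
    using N by (simp add: m_def of_nat_diff)
  have "m * (f xhat - f xstar) = (\<Sum>k\<in>{0..N} - ?T. f xhat - f xstar)"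
    using card by simp
  also have "\<dots> \<le> (\<Sum>k\<in>{0..N} - ?T. f (x k) - f xstar)"
    using best by (intro sum_mono) auto
  also have "\<dots> \<le> A - B"
    using sum_gap_le[of N] nu_pos L0_pos
    by (simp add: A_def B_def T_def) (smt (verit) divide_nonneg_pos mult_nonneg_nonneg zero_le_power2)
  finally have "f xhat - f xstar \<le> A / m - B / m"
    using m by (simp add: field_simps)
  then show ?thesis by (simp add: A_def B_def m_def mult_ac)
qed

lemma best_iterate_gap_le':
  assumes N: "real N > 16 * L1\<^sup>2 * (norm (x 0 - xstar))\<^sup>2 / \<nu>\<^sup>2 - 1"
    and best: "f xhat = Min (f ` x ` {0..N})"
  shows "f xhat - f xstar \<le> 4 * L0 * (norm (x 0 - xstar))\<^sup>2 / (\<nu> * (real N + 1))"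
proof -
  define T where "T = card (large_grad f L0 L1 x N)"
  define a where "a = (norm (x 0 - xstar))\<^sup>2"
  define c where "c = \<nu>\<^sup>2 / (16 * L1\<^sup>2)"
  define m where "m = real N - real T + 1"
  have m: "m > 0" using card_large_less[OF N] by (simp add: m_def T_def)
  have "a \<le> c * (real N + 1)"
    using N nu_pos L1_pos by (simp add: a_def c_def field_simps)
  then have "a * real T \<le> c * (real N + 1) * real T" by (intro mult_right_mono) auto
  \<comment> \<open>After clearing denominators this reads
    \<open>a * T \<le> c * (N + 1) * T\<close>, and the assumption on \<open>N\<close> says
    \<open>a < c * (N + 1)\<close>.\<close>
  then have "(a - c * real T) / m \<le> a / (real N + 1)"
    using m by (simp add: divide_simps) (simp add: m_def algebra_simps)
  then have le: "4 * L0 / \<nu> * ((a - c * real T) / m) \<le> 4 * L0 / \<nu> * (a / (real N + 1))"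
    using L0_pos nu_pos by (intro mult_left_mono) auto
  have "f xhat - f xstar \<le> 4 * L0 * a / (\<nu> * m) - \<nu> * L0 * real T / (4 * L1\<^sup>2 * m)"
    using best_iterate_gap_le[OF _ best] m by (simp add: a_def m_def T_def)
  also have "\<dots> = 4 * L0 / \<nu> * ((a - c * real T) / m)"
    using m L0_pos L1_pos nu_pos by (simp add: c_def power2_eq_square field_simps)
  finally show ?thesis using le by (simp add: a_def)
qed

text \<open>If \<open>x N\<close> has a large gradient, the last index before \<open>N\<close> with a small gradient takes the
  place of \<open>N\<close> among the \<open>T\<close> counted steps: its successor has a large gradient.\<close>

lemma strong_dist_le:
  fixes N
  defines "T \<equiv> card (large_grad f L0 L1 x N)"
  assumes mu: "\<mu> > 0" "strongly_convex \<mu> f"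
    and N: "real N > 16 * L1\<^sup>2 * (norm (x 0 - xstar))\<^sup>2 / \<nu>\<^sup>2 - 1"
  shows "(norm (x N - xstar))\<^sup>2 \<le> (1 - \<mu> * \<nu> / (8 * L0)) ^ (N - T)
    * ((norm (x 0 - xstar))\<^sup>2 - \<nu>\<^sup>2 * real T / (16 * L1\<^sup>2))"
proof -
  define \<T> where "\<T> = large_grad f L0 L1 x N"
  define c where "c = \<nu>\<^sup>2 / (16 * L1\<^sup>2)"
  define q where "q = 1 - \<mu> * \<nu> / (8 * L0)"
  define a where "a k = (norm (x k - xstar))\<^sup>2" for k
  have \<T>: "\<T> \<subseteq> {0..N}" "finite \<T>" by (auto simp: \<T>_def large_grad_def)
  have large: "L0 / L1 \<le> norm (grad f (x k))" if "k \<in> \<T>" for k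
    using that by (simp add: \<T>_def large_grad_def)
  have contr: "a (Suc k) \<le> q * a k" if "k < N" "k \<notin> \<T>" for k
  proof -
    have "norm (grad f (x k)) < L0 / L1" using that by (simp add: \<T>_def large_grad_def)
    from dist_step_small[OF this]
    have "a (Suc k) \<le> a k - \<nu> / (4 * L0) * (f (x k) - f xstar)" by (simp add: a_def step)
    also have "\<dots> \<le> a k - \<nu> / (4 * L0) * (\<mu> / 2 * a k)"
      unfolding a_def using gap_ge_strong[OF mu(2)] nu_pos L0_pos
      by (intro diff_left_mono mult_left_mono) auto
    also have "\<dots> = q * a k" by (simp add: q_def algebra_simps)
    finally show ?thesis .
  qed
  \<comment> \<open>Thus the subtraction in the exponent \<open>N - T\<close> is not truncated, and
    at least one of the \<open>N + 1\<close> indices has a small gradient.\<close>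
  have TN: "T \<le> N" using card_large_less[OF N] by (simp add: T_def)
  \<comment> \<open>\<open>S\<close> collects exactly \<open>T\<close> of the \<open>N\<close> steps
    actually taken to reach \<open>x N\<close>. The third property gives the constant decrease on
    \<open>S\<close>, the fourth the contraction outside it.\<close>
  obtain S where S: "S \<subseteq> {..<N}" "card S = T"
    "\<And>k. k \<in> S \<Longrightarrow> k \<in> \<T> \<or> Suc k \<in> \<T>" "\<T> \<inter> {..<N} \<subseteq> S"
  proof (cases "N \<in> \<T>")
    case False
    have "\<T> \<subseteq> {..<N}"
    proof
      fix k assume "k \<in> \<T>"
      with \<T>(1) False show "k \<in> {..<N}" by (cases "k = N") auto
    qed
    then show ?thesis by (intro that[of \<T>]) (auto simp: T_def \<T>_def)
  next
    case True
    define R where "R = {..<N} - \<T>"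
    have "R \<noteq> {}"
    proof
      assume "R = {}"
      with True \<T>(1) have "\<T> = {0..N}"
        unfolding R_def by (auto simp: le_less)
      with TN show False by (simp add: T_def \<T>_def)
    qed
    define j where "j = Max R"
    have j: "j \<in> R" unfolding j_def using \<open>R \<noteq> {}\<close> by (intro Max_in) (simp_all add: R_def)
    have "Suc j \<notin> R"
    proof
      assume "Suc j \<in> R"
      then have "Suc j \<le> j" unfolding j_def by (intro Max_ge) (simp_all add: R_def)
      then show False by simp
    qed
    \<comment> \<open>By maximality of \<open>j\<close>, its successor is either \<open>N\<close>
      itself or an index below \<open>N\<close> outside \<open>R\<close>; both lie in
      \<open>\<T>\<close>.\<close>
    with j True have Sj: "Suc j \<in> \<T>"
      by (cases "Suc j = N") (auto simp: R_def)
    have "card (insert j (\<T> - {N})) = T"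
      using j True \<T>(2) card_Suc_Diff1[OF \<T>(2) True] by (simp add: R_def T_def \<T>_def)
    moreover have "insert j (\<T> - {N}) \<subseteq> {..<N}"
    proof
      fix k assume "k \<in> insert j (\<T> - {N})"
      with \<T>(1) j show "k \<in> {..<N}" by (cases "k = N") (auto simp: R_def)
    qed
    ultimately show ?thesis
      using Sj by (intro that[of "insert j (\<T> - {N})"]) auto
  qed
  have dec: "a (Suc k) \<le> a k - c" if "k \<in> S" for k
    using S(3)[OF that] dist_step_large[OF large[of k]] dist_step_large_next[of "x k"]
      large[of "Suc k"]
    by (auto simp: a_def c_def step)
  have "a N \<le> q ^ (N - card (S \<inter> {..<N})) * (a 0 - c * real (card (S \<inter> {..<N})))"
  proof (rule contraction_count)
    show "0 \<le> q" "q \<le> 1" unfolding q_def by (rule strong_contraction_factor[OF mu])+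
    show "0 \<le> c" by (simp add: c_def)
    show "a (Suc k) \<le> a k - c" if "k \<in> S" for k using that by (rule dec)
    show "a (Suc k) \<le> q * a k" if "k < N" "k \<notin> S" for k
      using that S(4) by (intro contr) auto
  qed
  moreover have "S \<inter> {..<N} = S" using S(1) by auto
  ultimately show ?thesis using S(2) by (simp add: a_def c_def q_def)
qed

end

end

theorem theoremE1:
  fixes f :: "real ^ 'n \<Rightarrow> real"
    and L0 L1 \<nu> :: real
    and xstar :: "real ^ 'n"
    and x :: "nat \<Rightarrow> real ^ 'n"
  assumes "f differentiable_on UNIV"
    and "strongly_convex 0 f"
    and "L0 > 0" and "L1 > 0"
    and "symm_smooth L0 L1 f"
    and "is_arg_min f (\<lambda>_. True) xstar"
    and "\<nu> = exp (- \<nu>)"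
    and "\<And>k. x (Suc k) = gd_ps_step f xstar (x k)"
  shows
    "(\<forall>k. norm (grad f (x k)) \<ge> L0 / L1 \<longrightarrow>
        (norm (x (k + 1) - xstar))\<^sup>2 \<le> (norm (x k - xstar))\<^sup>2 - \<nu>\<^sup>2 / (16 * L1\<^sup>2))
   \<and> (\<forall>N. let \<T> = large_grad f L0 L1 x N; T = card \<T> in
        4 * L0 / \<nu> * (norm (x (N + 1) - xstar))\<^sup>2 + (\<Sum>k\<in>{0..N} - \<T>. f (x k) - f xstar)
          \<le> 4 * L0 / \<nu> * (norm (x 0 - xstar))\<^sup>2 - \<nu> * L0 * real T / (4 * L1\<^sup>2)
      \<and> (real N > real T - 1 \<longrightarrow>
          (\<forall>xhat \<in> x ` {0..N}. f xhat = Min (f ` x ` {0..N}) \<longrightarrow>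
            f xhat - f xstar \<le>
              4 * L0 * (norm (x 0 - xstar))\<^sup>2 / (\<nu> * (real N - real T + 1))
                - \<nu> * L0 * real T / (4 * L1\<^sup>2 * (real N - real T + 1))))
      \<and> (real N > 16 * L1\<^sup>2 * (norm (x 0 - xstar))\<^sup>2 / \<nu>\<^sup>2 - 1 \<longrightarrow>
          real N > real T - 1
        \<and> (\<forall>xhat \<in> x ` {0..N}. f xhat = Min (f ` x ` {0..N}) \<longrightarrow>
            f xhat - f xstar \<le> 4 * L0 * (norm (x 0 - xstar))\<^sup>2 / (\<nu> * (real N + 1))))
      \<and> (\<forall>\<mu>. \<mu> > 0 \<and> strongly_convex \<mu> f
            \<and> real N > 16 * L1\<^sup>2 * (norm (x 0 - xstar))\<^sup>2 / \<nu>\<^sup>2 - 1 \<longrightarrow>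
          (norm (x N - xstar))\<^sup>2
            \<le> (1 - \<mu> * \<nu> / (8 * L0)) ^ (N - T)
                * ((norm (x 0 - xstar))\<^sup>2 - \<nu>\<^sup>2 * real T / (16 * L1\<^sup>2))
        \<and> (1 - \<mu> * \<nu> / (8 * L0)) ^ (N - T)
                * ((norm (x 0 - xstar))\<^sup>2 - \<nu>\<^sup>2 * real T / (16 * L1\<^sup>2))
            \<le> (1 - \<mu> * \<nu> / (8 * L0)) ^ (N - T) * (norm (x 0 - xstar))\<^sup>2))"
proof -
  interpret convex_symm_smooth_min f L0 L1 xstar \<nu>
    using assms by unfold_locales
  note step = assms(8)
  show ?thesis
    unfolding Let_def
  proof (intro conjI allI impI ballI)
    fix k assume "L0 / L1 \<le> norm (grad f (x k))"
    then show "(norm (x (k + 1) - xstar))\<^sup>2 \<le> (norm (x k - xstar))\<^sup>2 - \<nu>\<^sup>2 / (16 * L1\<^sup>2)"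
      using dist_step_large step by simp
  next
    fix N
    show "4 * L0 / \<nu> * (norm (x (N + 1) - xstar))\<^sup>2
        + (\<Sum>k\<in>{0..N} - large_grad f L0 L1 x N. f (x k) - f xstar)
      \<le> 4 * L0 / \<nu> * (norm (x 0 - xstar))\<^sup>2
        - \<nu> * L0 * real (card (large_grad f L0 L1 x N)) / (4 * L1\<^sup>2)"
      using sum_gap_le[where x = x, OF step] by simp
  next
    fix N xhat
    assume "real N > real (card (large_grad f L0 L1 x N)) - 1" "f xhat = Min (f ` x ` {0..N})"
    then show "f xhat - f xstar \<le>
        4 * L0 * (norm (x 0 - xstar))\<^sup>2 / (\<nu> * (real N - real (card (large_grad f L0 L1 x N)) + 1))
        - \<nu> * L0 * real (card (large_grad f L0 L1 x N))
          / (4 * L1\<^sup>2 * (real N - real (card (large_grad f L0 L1 x N)) + 1))"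
      by (rule best_iterate_gap_le[where x = x, OF step])
  next
    fix N
    assume "real N > 16 * L1\<^sup>2 * (norm (x 0 - xstar))\<^sup>2 / \<nu>\<^sup>2 - 1"
    from card_large_less[where x = x, OF step this]
    show "real N > real (card (large_grad f L0 L1 x N)) - 1" by simp
  next
    fix N xhat
    assume "real N > 16 * L1\<^sup>2 * (norm (x 0 - xstar))\<^sup>2 / \<nu>\<^sup>2 - 1" "f xhat = Min (f ` x ` {0..N})"
    then show "f xhat - f xstar \<le> 4 * L0 * (norm (x 0 - xstar))\<^sup>2 / (\<nu> * (real N + 1))"
      by (rule best_iterate_gap_le'[where x = x, OF step])
  next
    fix N \<mu>
    assume mu: "\<mu> > 0 \<and> strongly_convex \<mu> f
      \<and> real N > 16 * L1\<^sup>2 * (norm (x 0 - xstar))\<^sup>2 / \<nu>\<^sup>2 - 1"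
    let ?T = "card (large_grad f L0 L1 x N)"
    show "(norm (x N - xstar))\<^sup>2 \<le> (1 - \<mu> * \<nu> / (8 * L0)) ^ (N - ?T)
        * ((norm (x 0 - xstar))\<^sup>2 - \<nu>\<^sup>2 * real ?T / (16 * L1\<^sup>2))"
      using strong_dist_le[where x = x, OF step] mu by blast
    have "0 \<le> (1 - \<mu> * \<nu> / (8 * L0)) ^ (N - ?T)"
      using mu by (intro zero_le_power strong_contraction_factor(1)) auto
    then show "(1 - \<mu> * \<nu> / (8 * L0)) ^ (N - ?T)
        * ((norm (x 0 - xstar))\<^sup>2 - \<nu>\<^sup>2 * real ?T / (16 * L1\<^sup>2))
      \<le> (1 - \<mu> * \<nu> / (8 * L0)) ^ (N - ?T) * (norm (x 0 - xstar))\<^sup>2"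
      by (intro mult_left_mono) auto
  qed
qed

end
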